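(* Let $G$ be a tricyclic graph with $n$ vertices. Then $$EM_1(G)\leq n^3-5n^2+20n+32,$$ and equality holds if and only if $G\cong S_n^{n+2}$ or $G\cong S_n^{K_4}$.
   Context: All graphs are finite, simple and undirected. A tricyclic graph with $n$ vertices is a connected simple graph with $n$ vertices and exactly $n+2$ edges. For an edge $e=uv$ of a graph $G$, the degree of $e$ is $\deg(e)=\deg(u)+\deg(v)-2$. The first reformulated Zagreb index of $G$ is $EM_1(G)=\sum_{e\in E(G)}\deg(e)^2$. $S_n$ denotes the star on $n$ vertices. $S_n^m$ denotes the graph (with $n$ vertices and $m$ edges) obtained from $S_n$ by joining one pendent vertex to $m-n+1$ other pendent vertices; thus $S_n^{n+2}$ (which exists for $n\geq 5$) is obtained from $S_n$ by joining one pendent vertex to three other pendent vertices. $S_n^{K_4}$ (for $n\geq 4$) is the graph obtained from the complete graph $K_4$ by attaching $n-4$ pendent vertices to one of its vertices. *)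

theory Defs
  imports Main
begin

text \<open>A graph is a pair of a vertex set and a set of edges, an edge being a two-element set of
  vertices; no loops, parallel edges or orientations arise.\<close>

type_synonym 'a graph = "'a set \<times> 'a set set"

abbreviation verts :: "'a graph \<Rightarrow> 'a set" where
  "verts G \<equiv> fst G"

abbreviation edges :: "'a graph \<Rightarrow> 'a set set" where
  "edges G \<equiv> snd G"

definition all_edges :: "'a set \<Rightarrow> 'a set set" where
  "all_edges A = {e. e \<subseteq> A \<and> card e = 2}"

definition simple_graph :: "'a graph \<Rightarrow> bool" where
  "simple_graph G \<longleftrightarrow> finite (verts G) \<and> edges G \<subseteq> all_edges (verts G)"

definition adj_rel :: "'a graph \<Rightarrow> ('a \<times> 'a) set" where
  "adj_rel G = {(u, v). {u, v} \<in> edges G}"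

definition connected_graph :: "'a graph \<Rightarrow> bool" where
  "connected_graph G \<longleftrightarrow> verts G \<noteq> {} \<and> (\<forall>u\<in>verts G. \<forall>v\<in>verts G. (u, v) \<in> (adj_rel G)\<^sup>*)"

definition tricyclic :: "nat \<Rightarrow> 'a graph \<Rightarrow> bool" where
  "tricyclic n G \<longleftrightarrow> simple_graph G \<and> connected_graph G \<and>
     card (verts G) = n \<and> card (edges G) = n + 2"

definition degree :: "'a graph \<Rightarrow> 'a \<Rightarrow> nat" where
  "degree G v = card {e \<in> edges G. v \<in> e}"

text \<open>For an edge \<open>e = {u, v}\<close> the sum has exactly the two summands \<open>degree G u\<close> and
  \<open>degree G v\<close>.\<close>

definition edge_degree :: "'a graph \<Rightarrow> 'a set \<Rightarrow> int" where
  "edge_degree G e = (\<Sum>v\<in>e. int (degree G v)) - 2"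

definition EM1 :: "'a graph \<Rightarrow> int" where
  "EM1 G = (\<Sum>e\<in>edges G. (edge_degree G e)\<^sup>2)"

definition graph_iso :: "'a graph \<Rightarrow> 'b graph \<Rightarrow> bool" (infix "\<cong>\<^sub>g" 50) where
  "G \<cong>\<^sub>g H \<longleftrightarrow> (\<exists>f. bij_betw f (verts G) (verts H) \<and> edges H = (`) f ` edges G)"

text \<open>The centre of the star is \<open>0\<close>; its pendent vertices are \<open>1, \<dots>, n - 1\<close>.\<close>

definition star :: "nat \<Rightarrow> nat graph" where
  "star n = ({..<n}, {{0, i} | i. 1 \<le> i \<and> i < n})"

text \<open>The graph \<open>S\<^sub>n\<^sup>m\<close>: the pendent vertex \<open>1\<close> of the star is joined to the \<open>m - n + 1\<close> pendent
  vertices \<open>2, \<dots>, m - n + 2\<close>. This is meaningful only if \<open>n \<le> m + 1\<close> and all these vertices lie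
  below \<open>n\<close>, that is, \<open>m + 3 \<le> 2 * n\<close>; for \<open>m = n + 2\<close> this means \<open>n \<ge> 5\<close>.\<close>

definition star_join :: "nat \<Rightarrow> nat \<Rightarrow> nat graph" where
  "star_join n m = (verts (star n), edges (star n) \<union> {{1, j} | j. 2 \<le> j \<and> j < 2 + (m + 1 - n)})"

text \<open>The graph \<open>S\<^sub>n\<close> with superscript \<open>K\<^sub>4\<close>, meaningful for \<open>n \<ge> 4\<close>: the complete graph on
  \<open>0, 1, 2, 3\<close> with the \<open>n - 4\<close> pendent vertices \<open>4, \<dots>, n - 1\<close> attached to the vertex \<open>0\<close>.\<close>

definition star_K4 :: "nat \<Rightarrow> nat graph" where
  "star_K4 n = ({..<n}, all_edges {..<4} \<union> {{0, i} | i. 4 \<le> i \<and> i < n})"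

end

theory Submission
  imports Defs
begin

text \<open>Put \<open>f n = n\<^sup>3 - 5 n\<^sup>2 + 20 n + 32\<close> and induct on \<open>n\<close>. Deleting a pendant vertex whose neighbour
  has degree \<open>d\<close> lowers \<open>EM\<^sub>1\<close> by at most \<open>3 d\<^sup>2 - 9 d + 2 n + 14\<close>, and this is at most
  \<open>f n - f (n - 1)\<close>, with equality only for \<open>d = n - 1\<close>. If there is no pendant vertex, the excesses
  \<open>x v = deg v - 2\<close> are nonnegative, have sum \<open>4\<close> and are at most \<open>n - 3\<close>; expanding \<open>EM\<^sub>1\<close> in them
  gives \<open>EM\<^sub>1 \<le> 4 n + 56 + (\<Sum>v. x v ^ 3 + 5 * x v ^ 2) \<le> 4 n\<^sup>2 + 32 = f n - n (n - 4) (n - 5)\<close>.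

  For equality the induction carries the statement that some vertex is adjacent to all others and
  that the three edges avoiding any such vertex form a claw or a triangle. Quantifying over all
  such vertices is what lets the step go through: the neighbour of the deleted vertex need not be
  the centre by which the smaller graph was recognised.\<close>

section \<open>Double counting\<close>

lemma simple_graph_finite:
  assumes "simple_graph G"
  shows "finite (verts G)" "finite (edges G)"
proof -
  show "finite (verts G)" using assms by (simp add: simple_graph_def)
  moreover have "edges G \<subseteq> Pow (verts G)"
    using assms by (auto simp: simple_graph_def all_edges_def)
  ultimately show "finite (edges G)" by (meson finite_Pow_iff finite_subset)
qed

lemma simple_graph_edge:
  assumes "simple_graph G" "e \<in> edges G"
  shows "e \<subseteq> verts G" "card e = 2" "finite e"
proof -
  show "e \<subseteq> verts G" and two: "card e = 2"
    using assms by (auto simp: simple_graph_def all_edges_def)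
  show "finite e" using two by (simp add: card_ge_0_finite)
qed

lemma edge_eq_insert:
  assumes "simple_graph G" "e \<in> edges G" "v \<in> e" "w \<in> e" "v \<noteq> w"
  shows "e = {v, w}"
proof -
  have "card e = 2" "finite e" using simple_graph_edge assms by blast+
  moreover have "{v, w} \<subseteq> e" "card {v, w} = 2" using assms by auto
  ultimately show ?thesis by (metis card_subset_eq)
qed

lemma edge_obtain:
  assumes "simple_graph G" "e \<in> edges G" "v \<in> e"
  obtains w where "w \<noteq> v" "e = {v, w}" "w \<in> verts G"
proof -
  have "card e = 2" and sub: "e \<subseteq> verts G" using simple_graph_edge assms by blast+
  then obtain x y where "e = {x, y}" "x \<noteq> y" by (auto simp: card_2_iff)
  then show ?thesis using that[of x] that[of y] assms(3) sub by fastforce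
qed

lemma edge_neq:
  assumes "simple_graph G" "{v, w} \<in> edges G"
  shows "v \<noteq> w"
  using simple_graph_edge(2)[OF assms] by auto

text \<open>Both sides run over the incident pairs of a vertex and an edge of \<open>F\<close>. The
  family \<open>F\<close> stays free because it is taken to be all edges in some places and the
  edges at one vertex in others.\<close>

lemma sum_edges_swap:
  fixes g :: "'a set \<Rightarrow> 'a \<Rightarrow> int"
  assumes "simple_graph G" "F \<subseteq> edges G"
  shows "(\<Sum>e\<in>F. \<Sum>v\<in>e. g e v) = (\<Sum>v\<in>verts G. \<Sum>e\<in>{e \<in> F. v \<in> e}. g e v)"
proof -
  have fin: "finite (verts G)" "finite F"
    using simple_graph_finite[OF assms(1)] assms(2) by (auto intro: finite_subset)
  have "(\<Sum>e\<in>F. \<Sum>v\<in>e. g e v) = (\<Sum>e\<in>F. \<Sum>v\<in>{v \<in> verts G. v \<in> e}. g e v)"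
  proof (rule sum.cong)
    fix e assume "e \<in> F"
    then have "{v \<in> verts G. v \<in> e} = e"
      using simple_graph_edge(1)[OF assms(1)] assms(2) by auto
    then show "(\<Sum>v\<in>e. g e v) = (\<Sum>v\<in>{v \<in> verts G. v \<in> e}. g e v)" by simp
  qed simp
  also have "\<dots> = (\<Sum>v\<in>verts G. \<Sum>e\<in>{e \<in> F. v \<in> e}. g e v)"
    by (rule sum.swap_restrict[OF fin(2,1)])
  finally show ?thesis .
qed

lemma sum_edges_sum:
  fixes g :: "'a \<Rightarrow> int"
  assumes "simple_graph G" "F \<subseteq> edges G"
  shows "(\<Sum>e\<in>F. \<Sum>v\<in>e. g v) = (\<Sum>v\<in>verts G. int (card {e \<in> F. v \<in> e}) * g v)"
  by (simp add: sum_edges_swap[OF assms])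

lemma sum_degree:
  assumes "simple_graph G"
  shows "(\<Sum>v\<in>verts G. int (degree G v)) = 2 * int (card (edges G))"
proof -
  have "(\<Sum>v\<in>verts G. int (degree G v)) = (\<Sum>e\<in>edges G. \<Sum>v\<in>e. 1)"
    using sum_edges_sum[OF assms, of "edges G" "\<lambda>_. 1"] by (simp add: degree_def)
  also have "\<dots> = (\<Sum>e\<in>edges G. 2)"
    using simple_graph_edge(2)[OF assms] by (intro sum.cong) auto
  finally show ?thesis by simp
qed

text \<open>In a simple graph this is the adjacency matrix off the diagonal and the degree on it. A
  vertex weight summed over the edges at \<open>v\<close> thus becomes a linear form over all
  vertices, which can be estimated term by term.\<close>

definition codegree :: "'a graph \<Rightarrow> 'a \<Rightarrow> 'a \<Rightarrow> nat" where
  "codegree G v w = card {e \<in> edges G. v \<in> e \<and> w \<in> e}"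

lemma codegree_self [simp]: "codegree G v v = degree G v"
  by (simp add: codegree_def degree_def)

lemma codegree_le_1:
  assumes "simple_graph G" "v \<noteq> w"
  shows "codegree G v w \<le> 1"
proof -
  have "{e \<in> edges G. v \<in> e \<and> w \<in> e} \<subseteq> {{v, w}}"
    using edge_eq_insert[OF assms(1)] assms(2) by blast
  then show ?thesis unfolding codegree_def
    by (metis card_mono card.empty card_insert_disjoint finite.emptyI finite.insertI
        empty_iff One_nat_def)
qed

lemma sum_incident_edges_sum:
  fixes g :: "'a \<Rightarrow> int"
  assumes "simple_graph G"
  shows "(\<Sum>e\<in>{e \<in> edges G. v \<in> e}. \<Sum>w\<in>e. g w) = (\<Sum>w\<in>verts G. int (codegree G v w) * g w)"
  using sum_edges_sum[OF assms, of "{e \<in> edges G. v \<in> e}" g]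
  by (simp add: codegree_def conj_assoc)

lemma incident_edges_image:
  assumes "simple_graph G"
  shows "{e \<in> edges G. v \<in> e} = (\<lambda>w. {v, w}) ` {w. {v, w} \<in> edges G}"
proof
  show "{e \<in> edges G. v \<in> e} \<subseteq> (\<lambda>w. {v, w}) ` {w. {v, w} \<in> edges G}"
    using edge_obtain[OF assms] by blast
qed auto

lemma degree_eq_card_neighbours:
  assumes "simple_graph G"
  shows "degree G v = card {w. {v, w} \<in> edges G}"
  unfolding degree_def incident_edges_image[OF assms]
  by (rule card_image) (auto simp: inj_on_def doubleton_eq_iff)

lemma neighbours_subset:
  assumes "simple_graph G"
  shows "{w. {v, w} \<in> edges G} \<subseteq> verts G - {v}"
  using simple_graph_edge(1)[OF assms] edge_neq[OF assms] by blast

lemma degree_less_card: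
  assumes "simple_graph G" "v \<in> verts G"
  shows "degree G v < card (verts G)"
proof -
  have "degree G v \<le> card (verts G - {v})"
    unfolding degree_eq_card_neighbours[OF assms(1)]
    using neighbours_subset[OF assms(1)] simple_graph_finite[OF assms(1)]
    by (intro card_mono) auto
  then show ?thesis using assms(2) simple_graph_finite(1)[OF assms(1)]
    by (metis card_Diff1_less order_le_less_trans)
qed

section \<open>Dominating vertices\<close>

definition dominating :: "'a graph \<Rightarrow> 'a \<Rightarrow> bool" where
  "dominating G c \<longleftrightarrow> c \<in> verts G \<and> (\<forall>w\<in>verts G - {c}. {c, w} \<in> edges G)"

lemma dominating_iff_degree:
  assumes "simple_graph G" "c \<in> verts G"
  shows "dominating G c \<longleftrightarrow> degree G c = card (verts G) - 1"
proof -
  have sub: "{w. {c, w} \<in> edges G} \<subseteq> verts G - {c}" by (rule neighbours_subset[OF assms(1)])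
  have fin: "finite (verts G - {c})" using simple_graph_finite(1)[OF assms(1)] by simp
  have "dominating G c \<longleftrightarrow> {w. {c, w} \<in> edges G} = verts G - {c}"
    using sub assms(2) by (auto simp: dominating_def)
  also have "\<dots> \<longleftrightarrow> card {w. {c, w} \<in> edges G} = card (verts G - {c})"
    by (rule iffI) (simp, rule card_subset_eq[OF fin sub])
  also have "\<dots> \<longleftrightarrow> degree G c = card (verts G) - 1"
    using assms by (simp add: degree_eq_card_neighbours card_Diff_singleton)
  finally show ?thesis .
qed

text \<open>Used in two ways: as what remains beside the star at a dominating vertex, and as the
  edge set left when a vertex is deleted.\<close>

definition edges_avoiding :: "'a graph \<Rightarrow> 'a \<Rightarrow> 'a set set" where
  "edges_avoiding G c = {e \<in> edges G. c \<notin> e}"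

lemma dominating_edges:
  assumes "simple_graph G" "dominating G c"
  shows "edges G = (\<lambda>w. {c, w}) ` (verts G - {c}) \<union> edges_avoiding G c"
proof
  show "edges G \<subseteq> (\<lambda>w. {c, w}) ` (verts G - {c}) \<union> edges_avoiding G c"
  proof
    fix e assume e: "e \<in> edges G"
    show "e \<in> (\<lambda>w. {c, w}) ` (verts G - {c}) \<union> edges_avoiding G c"
    proof (cases "c \<in> e")
      case True
      then show ?thesis using edge_obtain[OF assms(1) e] by blast
    qed (simp add: e edges_avoiding_def)
  qed
  show "(\<lambda>w. {c, w}) ` (verts G - {c}) \<union> edges_avoiding G c \<subseteq> edges G"
    using assms(2) by (auto simp: edges_avoiding_def dominating_def)
qed

text \<open>The shape off the centre of \<open>star_join n (n + 2)\<close>. Only edges are recorded,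
  so that isolated vertices, whose number depends on \<open>n\<close>, do not enter.\<close>

definition is_claw :: "'a set set \<Rightarrow> bool" where
  "is_claw H \<longleftrightarrow> (\<exists>a p q r. distinct [a, p, q, r] \<and> H = {{a, p}, {a, q}, {a, r}})"

text \<open>The shape off the centre of \<open>star_K4 n\<close>.\<close>

definition is_triangle :: "'a set set \<Rightarrow> bool" where
  "is_triangle H \<longleftrightarrow> (\<exists>p q r. distinct [p, q, r] \<and> H = {{p, q}, {p, r}, {q, r}})"

text \<open>With \<open>n\<close> vertices in all, the centre has degree \<open>n - 1\<close> and
  every other \<open>w\<close> has degree \<open>1 + h w\<close>, where \<open>h\<close> is the
  degree within \<open>H\<close>. So \<open>{c, w}\<close> has degree \<open>n - 2 + h w\<close>,
  and for an edge of \<open>H\<close> the two ones at its ends cancel the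
  \<open>- 2\<close>.\<close>

lemma EM1_dominating:
  assumes "simple_graph G" "dominating G c"
  defines "H \<equiv> edges_avoiding G c"
  defines "h \<equiv> \<lambda>v. int (card {e \<in> H. v \<in> e})"
  shows "EM1 G = (\<Sum>w\<in>verts G - {c}. (int (card (verts G)) - 2 + h w)\<^sup>2) + (\<Sum>e\<in>H. (\<Sum>v\<in>e. h v)\<^sup>2)"
proof -
  let ?S = "(\<lambda>w. {c, w}) ` (verts G - {c})"
  have E: "edges G = ?S \<union> H" unfolding H_def by (rule dominating_edges[OF assms(1,2)])
  have disj: "?S \<inter> H = {}" by (auto simp: H_def edges_avoiding_def)
  have fin: "finite (verts G)" "finite ?S" "finite H"
    using simple_graph_finite[OF assms(1)] by (auto simp: H_def edges_avoiding_def)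
  have c: "c \<in> verts G" using assms(2) by (simp add: dominating_def)
  have inj: "inj_on (\<lambda>w. {c, w}) (verts G - {c})"
    by (auto simp: inj_on_def doubleton_eq_iff)
  have pos: "card (verts G) > 0" using c fin card_gt_0_iff by blast
  have degc: "int (degree G c) = int (card (verts G)) - 1"
    using dominating_iff_degree[OF assms(1) c] assms(2) pos by simp
  have deg: "int (degree G w) = 1 + h w" if "w \<in> verts G - {c}" for w
  proof -
    have "{e \<in> edges G. w \<in> e} = insert {c, w} {e \<in> H. w \<in> e}"
      unfolding E using that by auto
    moreover have "{c, w} \<notin> {e \<in> H. w \<in> e}" by (auto simp: H_def edges_avoiding_def)
    ultimately show ?thesis using fin by (simp add: degree_def h_def)
  qed
  have "EM1 G = (\<Sum>e\<in>?S. (edge_degree G e)\<^sup>2) + (\<Sum>e\<in>H. (edge_degree G e)\<^sup>2)"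
    unfolding EM1_def E using sum.union_disjoint[OF fin(2,3) disj] .
  also have "(\<Sum>e\<in>?S. (edge_degree G e)\<^sup>2) = (\<Sum>w\<in>verts G - {c}. (edge_degree G {c, w})\<^sup>2)"
    by (simp add: sum.reindex[OF inj])
  also have "\<dots> = (\<Sum>w\<in>verts G - {c}. (int (card (verts G)) - 2 + h w)\<^sup>2)"
    by (rule sum.cong) (auto simp: edge_degree_def degc deg algebra_simps)
  also have "(\<Sum>e\<in>H. (edge_degree G e)\<^sup>2) = (\<Sum>e\<in>H. (\<Sum>v\<in>e. h v)\<^sup>2)"
  proof (rule sum.cong)
    fix e assume e: "e \<in> H"
    then have "e \<in> edges G" "c \<notin> e" by (auto simp: H_def edges_avoiding_def)
    then have "e \<subseteq> verts G - {c}" "card e = 2"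
      using simple_graph_edge[OF assms(1)] by auto
    then have "(\<Sum>v\<in>e. int (degree G v)) = (\<Sum>v\<in>e. 1 + h v)"
      using deg by (intro sum.cong) blast+
    then show "(edge_degree G e)\<^sup>2 = (\<Sum>v\<in>e. h v)\<^sup>2"
      using \<open>card e = 2\<close> by (simp add: edge_degree_def sum.distrib)
  qed simp
  finally show ?thesis .
qed

section \<open>Graphs that attain the bound\<close>

definition extremal_value :: "nat \<Rightarrow> int" where
  "extremal_value n = int n ^ 3 - 5 * int n ^ 2 + 20 * int n + 32"

lemma edges_avoiding_subset:
  assumes "simple_graph G" "e \<in> edges_avoiding G c"
  shows "e \<subseteq> verts G - {c}"
  using assms simple_graph_edge(1)[OF assms(1)] by (auto simp: edges_avoiding_def)

text \<open>Isolates the few vertices where \<open>h\<close> is nonzero; all others contribute the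
  same square. Counting them by an integer difference avoids truncated subtraction.\<close>

lemma sum_support:
  fixes g :: "'a \<Rightarrow> int"
  assumes "finite A" "B \<subseteq> A" "\<And>w. w \<in> A - B \<Longrightarrow> g w = k"
  shows "(\<Sum>w\<in>A. g w) = (\<Sum>w\<in>B. g w) + (int (card A) - int (card B)) * k"
proof -
  have "(\<Sum>w\<in>A. g w) = (\<Sum>w\<in>A - B. g w) + (\<Sum>w\<in>B. g w)"
    using sum.subset_diff[OF assms(2,1)] .
  also have "(\<Sum>w\<in>A - B. g w) = int (card (A - B)) * k" using assms(3) by simp
  also have "int (card (A - B)) = int (card A) - int (card B)"
    using assms card_mono[OF assms(1,2)] by (simp add: card_Diff_subset finite_subset of_nat_diff)
  finally show ?thesis by simp
qed

lemma EM1_dominating_claw: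
  assumes G: "simple_graph G" "dominating G c" and H: "is_claw (edges_avoiding G c)"
  shows "EM1 G = extremal_value (card (verts G))"
proof -
  obtain a p q r where d: "distinct [a, p, q, r]" and
    E: "edges_avoiding G c = {{a, p}, {a, q}, {a, r}}"
    using H unfolding is_claw_def by blast
  define h where "h v = int (card {e \<in> edges_avoiding G c. v \<in> e})" for v
  have fin: "finite (verts G)" "c \<in> verts G"
    using G(2) simple_graph_finite(1)[OF G(1)] by (auto simp: dominating_def)
  then have pos: "card (verts G) > 0" using card_gt_0_iff by blast
  have sub: "{a, p, q, r} \<subseteq> verts G - {c}" using edges_avoiding_subset[OF G(1)] E by auto
  have "{e \<in> edges_avoiding G c. a \<in> e} = {{a, p}, {a, q}, {a, r}}"
    "{e \<in> edges_avoiding G c. p \<in> e} = {{a, p}}"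
    "{e \<in> edges_avoiding G c. q \<in> e} = {{a, q}}"
    "{e \<in> edges_avoiding G c. r \<in> e} = {{a, r}}"
    unfolding E using d by auto
  then have h: "h a = 3" "h p = 1" "h q = 1" "h r = 1"
    using d by (auto simp: h_def doubleton_eq_iff)
  have h0: "h w = 0" if "w \<notin> {a, p, q, r}" for w
  proof -
    have "{e \<in> edges_avoiding G c. w \<in> e} = {}" unfolding E using that by auto
    then show ?thesis by (metis card.empty h_def of_nat_0)
  qed
  let ?n = "int (card (verts G))"
  \<comment> \<open>Of the \<open>?n - 1\<close> vertices other than the centre, all but four lie
    off the claw.\<close>
  have "(\<Sum>w\<in>verts G - {c}. (?n - 2 + h w)\<^sup>2) =
      (\<Sum>w\<in>{a, p, q, r}. (?n - 2 + h w)\<^sup>2) + (?n - 1 - 4) * (?n - 2)\<^sup>2"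
    using sum_support[OF _ sub, of "\<lambda>w. (?n - 2 + h w)\<^sup>2" "(?n - 2)\<^sup>2"] d fin pos h0
    by (simp add: card_Diff_singleton of_nat_diff)
  also have "(\<Sum>w\<in>{a, p, q, r}. (?n - 2 + h w)\<^sup>2) = (?n + 1)\<^sup>2 + 3 * (?n - 1)\<^sup>2"
    using d h by simp
  finally have 1: "(\<Sum>w\<in>verts G - {c}. (?n - 2 + h w)\<^sup>2) =
      (?n + 1)\<^sup>2 + 3 * (?n - 1)\<^sup>2 + (?n - 5) * (?n - 2)\<^sup>2" by simp
  \<comment> \<open>Each of the three edges joins a vertex with \<open>h = 3\<close> to one with
    \<open>h = 1\<close> and contributes 16.\<close>
  have 2: "(\<Sum>e\<in>edges_avoiding G c. (\<Sum>v\<in>e. h v)\<^sup>2) = 48"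
    unfolding E using d h by (simp add: doubleton_eq_iff)
  show ?thesis
    using EM1_dominating[OF G] 1 2 unfolding h_def[symmetric] extremal_value_def
    by (simp add: power2_eq_square power3_eq_cube algebra_simps)
qed

text \<open>The value agrees with that of the claw because the vertex sum depends only on the order,
  on the sum of \<open>h\<close> and on the sum of its squares, which are 6 and 12 for both shapes,
  and in both each of the three edges has endpoint sum 4.\<close>

lemma EM1_dominating_triangle:
  assumes G: "simple_graph G" "dominating G c" and H: "is_triangle (edges_avoiding G c)"
  shows "EM1 G = extremal_value (card (verts G))"
proof -
  obtain p q r where d: "distinct [p, q, r]" and
    E: "edges_avoiding G c = {{p, q}, {p, r}, {q, r}}"
    using H unfolding is_triangle_def by blast
  define h where "h v = int (card {e \<in> edges_avoiding G c. v \<in> e})" for v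
  have fin: "finite (verts G)" "c \<in> verts G"
    using G(2) simple_graph_finite(1)[OF G(1)] by (auto simp: dominating_def)
  then have pos: "card (verts G) > 0" using card_gt_0_iff by blast
  have sub: "{p, q, r} \<subseteq> verts G - {c}" using edges_avoiding_subset[OF G(1)] E by auto
  have "{e \<in> edges_avoiding G c. p \<in> e} = {{p, q}, {p, r}}"
    "{e \<in> edges_avoiding G c. q \<in> e} = {{p, q}, {q, r}}"
    "{e \<in> edges_avoiding G c. r \<in> e} = {{p, r}, {q, r}}"
    unfolding E using d by auto
  then have h: "h p = 2" "h q = 2" "h r = 2"
    using d by (auto simp: h_def doubleton_eq_iff)
  have h0: "h w = 0" if "w \<notin> {p, q, r}" for w
  proof -
    have "{e \<in> edges_avoiding G c. w \<in> e} = {}" unfolding E using that by auto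
    then show ?thesis by (metis card.empty h_def of_nat_0)
  qed
  let ?n = "int (card (verts G))"
  have "(\<Sum>w\<in>verts G - {c}. (?n - 2 + h w)\<^sup>2) =
      (\<Sum>w\<in>{p, q, r}. (?n - 2 + h w)\<^sup>2) + (?n - 1 - 3) * (?n - 2)\<^sup>2"
    using sum_support[OF _ sub, of "\<lambda>w. (?n - 2 + h w)\<^sup>2" "(?n - 2)\<^sup>2"] d fin pos h0
    by (simp add: card_Diff_singleton of_nat_diff)
  also have "(\<Sum>w\<in>{p, q, r}. (?n - 2 + h w)\<^sup>2) = 3 * ?n\<^sup>2"
    using d h by simp
  finally have 1: "(\<Sum>w\<in>verts G - {c}. (?n - 2 + h w)\<^sup>2) = 3 * ?n\<^sup>2 + (?n - 4) * (?n - 2)\<^sup>2"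
    by simp
  have 2: "(\<Sum>e\<in>edges_avoiding G c. (\<Sum>v\<in>e. h v)\<^sup>2) = 48"
    unfolding E using d h by (simp add: doubleton_eq_iff)
  show ?thesis
    using EM1_dominating[OF G] 1 2 unfolding h_def[symmetric] extremal_value_def
    by (simp add: power2_eq_square power3_eq_cube algebra_simps)
qed

section \<open>Invariance under isomorphism and construction of isomorphisms\<close>

lemma EM1_graph_iso:
  assumes "simple_graph G" "G \<cong>\<^sub>g G'"
  shows "EM1 G = EM1 G'"
proof -
  obtain f where f: "bij_betw f (verts G) (verts G')" and E: "edges G' = (`) f ` edges G"
    using assms(2) unfolding graph_iso_def by blast
  have inj: "inj_on f (verts G)" using f by (simp add: bij_betw_def)
  have sub: "edges G \<subseteq> Pow (verts G)" using simple_graph_edge(1)[OF assms(1)] by auto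
  have inj2: "inj_on ((`) f) (edges G)"
    using inj_on_image_Pow[OF inj] sub inj_on_subset by blast
  have deg: "degree G' (f v) = degree G v" if "v \<in> verts G" for v
  proof -
    have "{e \<in> edges G'. f v \<in> e} = (`) f ` {e \<in> edges G. v \<in> e}"
    proof -
      have "f v \<in> f ` e \<longleftrightarrow> v \<in> e" if "e \<in> edges G" for e
        using inj_on_image_mem_iff[OF inj \<open>v \<in> verts G\<close>] sub that by blast
      then show ?thesis unfolding E by blast
    qed
    moreover have "inj_on ((`) f) {e \<in> edges G. v \<in> e}"
      by (rule inj_on_subset[OF inj2]) simp
    ultimately show ?thesis by (simp add: degree_def card_image)
  qed
  have ed: "edge_degree G' (f ` e) = edge_degree G e" if "e \<in> edges G" for e
  proof -
    have "e \<subseteq> verts G" using sub that by auto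
    then have "inj_on f e" using inj inj_on_subset by blast
    then have "(\<Sum>v\<in>f ` e. int (degree G' v)) = (\<Sum>v\<in>e. int (degree G' (f v)))"
      by (simp add: sum.reindex)
    also have "\<dots> = (\<Sum>v\<in>e. int (degree G v))" using \<open>e \<subseteq> verts G\<close> deg by (intro sum.cong) auto
    finally show ?thesis by (simp add: edge_degree_def)
  qed
  show ?thesis unfolding EM1_def E using ed by (simp add: sum.reindex[OF inj2])
qed

text \<open>Lets a bijection be prescribed on the few vertices that matter; the rest can be matched
  arbitrarily since the complements of the two lists have equal size.\<close>

lemma bij_betw_extending_lists:
  assumes "finite A" "finite B" "card A = card B"
    and "distinct xs" "distinct ys" "set xs \<subseteq> A" "set ys \<subseteq> B" "length xs = length ys"
  shows "\<exists>f. bij_betw f A B \<and> map f xs = ys"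
proof -
  have "card (A - set xs) = card (B - set ys)"
    using assms by (simp add: card_Diff_subset distinct_card)
  then obtain g where g: "bij_betw g (A - set xs) (B - set ys)"
    using assms finite_same_card_bij by (metis finite_Diff)
  \<comment> \<open>The two lists serve as a lookup table, and \<open>g\<close> is the fallback for
    vertices not listed.\<close>
  define f where "f x = (case map_of (zip xs ys) x of Some y \<Rightarrow> y | None \<Rightarrow> g x)" for x
  have nth: "f (xs ! i) = ys ! i" if "i < length xs" for i
    using that assms by (simp add: f_def map_of_zip_nth)
  have m: "map f xs = ys" using nth assms by (auto intro: nth_equalityI)
  have fg: "f x = g x" if "x \<in> A - set xs" for x
  proof -
    have "map_of (zip xs ys) x = None" using that assms by (simp add: map_of_zip_is_None)
    then show ?thesis by (simp add: f_def)
  qed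
  then have 1: "bij_betw f (A - set xs) (B - set ys)"
    using g bij_betw_cong[of _ f g] fg by blast
  have "f ` set xs = set ys" using m by (metis set_map)
  moreover have "inj_on f (set xs)" using m assms by (metis distinct_map)
  ultimately have "bij_betw f (set xs) (set ys)" by (simp add: bij_betw_def)
  then have "bij_betw f (set xs \<union> (A - set xs)) (set ys \<union> (B - set ys))"
    using 1 by (rule bij_betw_combine) auto
  then have "bij_betw f A B" using assms by (simp add: Un_absorb1)
  then show ?thesis using m by blast
qed

text \<open>A bijection that respects the centres carries one full star onto the other, so only the
  edges off the centre need checking.\<close>

lemma graph_iso_dominating:
  assumes G: "simple_graph G" "dominating G c" and G': "simple_graph G'" "dominating G' c'"
    and f: "bij_betw f (verts G) (verts G')" "f c = c'"
    and av: "edges_avoiding G' c' = (`) f ` edges_avoiding G c"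
  shows "G \<cong>\<^sub>g G'"
proof -
  have c: "c \<in> verts G" using G by (simp add: dominating_def)
  then have "f ` (verts G - {c}) = verts G' - {c'}"
    using f by (auto simp: bij_betw_def inj_on_def)
  then have "edges G' = (\<lambda>w. {f c, w}) ` f ` (verts G - {c}) \<union> (`) f ` edges_avoiding G c"
    using dominating_edges[OF G'] av f by simp
  also have "\<dots> = (`) f ` edges G"
    unfolding dominating_edges[OF G] image_Un by (simp add: image_image)
  finally show ?thesis using f unfolding graph_iso_def by blast
qed

lemma graph_iso_dominating_claw:
  assumes G: "simple_graph G" "dominating G c" "is_claw (edges_avoiding G c)"
    and G': "simple_graph G'" "dominating G' c'" "is_claw (edges_avoiding G' c')"
    and card: "card (verts G) = card (verts G')"
  shows "G \<cong>\<^sub>g G'"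
proof -
  obtain a p q r where d: "distinct [a, p, q, r]" and
    E: "edges_avoiding G c = {{a, p}, {a, q}, {a, r}}"
    using G(3) unfolding is_claw_def by blast
  obtain a' p' q' r' where d': "distinct [a', p', q', r']" and
    E': "edges_avoiding G' c' = {{a', p'}, {a', q'}, {a', r'}}"
    using G'(3) unfolding is_claw_def by blast
  have sub: "{a, p, q, r} \<subseteq> verts G - {c}" using edges_avoiding_subset[OF G(1)] E by auto
  have sub': "{a', p', q', r'} \<subseteq> verts G' - {c'}" using edges_avoiding_subset[OF G'(1)] E' by auto
  have "c \<in> verts G" "c' \<in> verts G'" using G G' by (auto simp: dominating_def)
  then obtain f where f: "bij_betw f (verts G) (verts G')"
    "map f [c, a, p, q, r] = [c', a', p', q', r']"
    using bij_betw_extending_lists[of "verts G" "verts G'" "[c, a, p, q, r]" "[c', a', p', q', r']"]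
      d d' sub sub' card simple_graph_finite(1)[OF G(1)] simple_graph_finite(1)[OF G'(1)] by auto
  then show ?thesis
    by (intro graph_iso_dominating[OF G(1,2) G'(1,2) f(1)]) (auto simp: E E')
qed

lemma graph_iso_dominating_triangle:
  assumes G: "simple_graph G" "dominating G c" "is_triangle (edges_avoiding G c)"
    and G': "simple_graph G'" "dominating G' c'" "is_triangle (edges_avoiding G' c')"
    and card: "card (verts G) = card (verts G')"
  shows "G \<cong>\<^sub>g G'"
proof -
  obtain p q r where d: "distinct [p, q, r]" and
    E: "edges_avoiding G c = {{p, q}, {p, r}, {q, r}}"
    using G(3) unfolding is_triangle_def by blast
  obtain p' q' r' where d': "distinct [p', q', r']" and
    E': "edges_avoiding G' c' = {{p', q'}, {p', r'}, {q', r'}}"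
    using G'(3) unfolding is_triangle_def by blast
  have sub: "{p, q, r} \<subseteq> verts G - {c}" using edges_avoiding_subset[OF G(1)] E by auto
  have sub': "{p', q', r'} \<subseteq> verts G' - {c'}" using edges_avoiding_subset[OF G'(1)] E' by auto
  have "c \<in> verts G" "c' \<in> verts G'" using G G' by (auto simp: dominating_def)
  then obtain f where f: "bij_betw f (verts G) (verts G')"
    "map f [c, p, q, r] = [c', p', q', r']"
    using bij_betw_extending_lists[of "verts G" "verts G'" "[c, p, q, r]" "[c', p', q', r']"]
      d d' sub sub' card simple_graph_finite(1)[OF G(1)] simple_graph_finite(1)[OF G'(1)] by auto
  then show ?thesis
    by (intro graph_iso_dominating[OF G(1,2) G'(1,2) f(1)]) (auto simp: E E')
qed

section \<open>The two named graphs\<close>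

lemma star_join_dominating_claw:
  assumes "5 \<le> n"
  shows "simple_graph (star_join n (n + 2))" "dominating (star_join n (n + 2)) 0"
    "is_claw (edges_avoiding (star_join n (n + 2)) 0)" "card (verts (star_join n (n + 2))) = n"
proof -
  \<comment> \<open>For \<open>m = n + 2\<close> the number of joined vertices is
    \<open>m + 1 - n = 3\<close>. The last of them is 4, which is a vertex because
    \<open>5 \<le> n\<close>.\<close>
  have H: "{{1, j} | j. 2 \<le> j \<and> j < 2 + (n + 2 + 1 - n)} = {{1, 2}, {1, 3}, {1, 4 :: nat}}"
  proof -
    have "{j. 2 \<le> j \<and> j < 2 + (n + 2 + 1 - n)} = {2, 3, 4}" by auto
    then show ?thesis by (auto simp: set_eq_iff)
  qed
  have E: "edges (star_join n (n + 2)) =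
      {{0, i} | i. 1 \<le> i \<and> i < n} \<union> {{1, 2}, {1, 3}, {1, 4}}"
    and V: "verts (star_join n (n + 2)) = {..<n}"
    unfolding star_join_def snd_conv fst_conv H by (simp_all add: star_def)
  show "simple_graph (star_join n (n + 2))"
    unfolding simple_graph_def E V using assms by (auto simp: all_edges_def)
  show "dominating (star_join n (n + 2)) 0"
    unfolding dominating_def E V using assms by (auto simp: Suc_le_eq)
  have "edges_avoiding (star_join n (n + 2)) 0 = {{1, 2}, {1, 3}, {1, 4}}"
    unfolding edges_avoiding_def E by auto
  moreover have "distinct [1, 2, 3, 4 :: nat]" by simp
  ultimately show "is_claw (edges_avoiding (star_join n (n + 2)) 0)"
    unfolding is_claw_def by blast
  show "card (verts (star_join n (n + 2))) = n" unfolding V by simp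
qed

lemma star_K4_dominating_triangle:
  assumes "4 \<le> n"
  shows "simple_graph (star_K4 n)" "dominating (star_K4 n) 0"
    "is_triangle (edges_avoiding (star_K4 n) 0)" "card (verts (star_K4 n)) = n"
proof -
  have E: "edges (star_K4 n) = all_edges {..<4} \<union> {{0, i} | i. 4 \<le> i \<and> i < n}"
    and V: "verts (star_K4 n) = {..<n}"
    by (simp_all add: star_K4_def)
  show "simple_graph (star_K4 n)"
    unfolding simple_graph_def E V using assms by (auto simp: all_edges_def)
  show "dominating (star_K4 n) 0"
    unfolding dominating_def E V using assms by (auto simp: all_edges_def)
  \<comment> \<open>The attached pendant edges all contain 0, so only the complete graph on four
    vertices contributes here.\<close>
  have "edges_avoiding (star_K4 n) 0 = {{1, 2}, {1, 3}, {2, 3}}"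
  proof
    show "edges_avoiding (star_K4 n) 0 \<subseteq> {{1, 2}, {1, 3}, {2, 3}}"
    proof
      fix e assume "e \<in> edges_avoiding (star_K4 n) 0"
      then have "e \<subseteq> {..<4}" "card e = 2" "0 \<notin> e"
        unfolding edges_avoiding_def E by (auto simp: all_edges_def)
      then obtain x y where xy: "e = {x, y}" "x \<noteq> y" by (auto simp: card_2_iff)
      then have "x \<in> {1, 2, 3}" "y \<in> {1, 2, 3}"
        using \<open>e \<subseteq> {..<4}\<close> \<open>0 \<notin> e\<close> by auto
      then show "e \<in> {{1, 2}, {1, 3}, {2, 3}}" using xy by auto
    qed
  qed (auto simp: edges_avoiding_def E all_edges_def)
  moreover have "distinct [1, 2, 3 :: nat]" by simp
  ultimately show "is_triangle (edges_avoiding (star_K4 n) 0)"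
    unfolding is_triangle_def by blast
  show "card (verts (star_K4 n)) = n" by (simp add: V)
qed

section \<open>Deleting a pendant vertex\<close>

lemma connected_degree_pos:
  assumes "simple_graph G" "connected_graph G" "2 \<le> card (verts G)" "v \<in> verts G"
  shows "1 \<le> degree G v"
proof -
  have "verts G \<noteq> {v}" using assms(3) by auto
  then obtain w where "w \<in> verts G" "w \<noteq> v" using assms(4) by blast
  then have "(v, w) \<in> (adj_rel G)\<^sup>*" using assms(2,4) by (auto simp: connected_graph_def)
  then obtain y where "(v, y) \<in> adj_rel G" using \<open>w \<noteq> v\<close> by (metis converse_rtranclE)
  then have "{v, y} \<in> {e \<in> edges G. v \<in> e}" by (simp add: adj_rel_def)
  then have "card {e \<in> edges G. v \<in> e} \<noteq> 0"
    using simple_graph_finite(2)[OF assms(1)] by (metis card_0_eq empty_iff finite_Collect_conjI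
        Collect_mem_eq)
  then show ?thesis by (simp add: degree_def)
qed

text \<open>The degree sum \<open>2 * (n + 2)\<close> is at most \<open>n * (n - 1)\<close>, and the
  difference factors as \<open>(n - 4) * (n + 1)\<close>.\<close>

lemma tricyclic_card_ge:
  assumes "tricyclic n G"
  shows "4 \<le> n"
proof -
  have G: "simple_graph G" "card (verts G) = n" "card (edges G) = n + 2"
    using assms by (auto simp: tricyclic_def)
  have "2 * (int n + 2) = (\<Sum>v\<in>verts G. int (degree G v))" using sum_degree[OF G(1)] G by simp
  also have "\<dots> \<le> (\<Sum>v\<in>verts G. int n - 1)"
    using degree_less_card[OF G(1)] G(2) by (intro sum_mono) fastforce
  finally have "0 \<le> (int n - 4) * (int n + 1)" using G by (simp add: algebra_simps)
  then show ?thesis by (simp add: zero_le_mult_iff)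
qed

definition delete_vertex :: "'a graph \<Rightarrow> 'a \<Rightarrow> 'a graph" where
  "delete_vertex G v = (verts G - {v}, edges_avoiding G v)"

lemma verts_delete_vertex [simp]: "verts (delete_vertex G v) = verts G - {v}"
  and edges_delete_vertex [simp]: "edges (delete_vertex G v) = edges_avoiding G v"
  by (simp_all add: delete_vertex_def)

lemma simple_graph_delete_vertex:
  assumes "simple_graph G"
  shows "simple_graph (delete_vertex G v)"
  using assms by (auto simp: simple_graph_def all_edges_def edges_avoiding_def)

lemma card_edges_avoiding:
  assumes "simple_graph G"
  shows "card (edges_avoiding G v) + degree G v = card (edges G)"
proof -
  have "edges G = edges_avoiding G v \<union> {e \<in> edges G. v \<in> e}"
    "edges_avoiding G v \<inter> {e \<in> edges G. v \<in> e} = {}"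
    by (auto simp: edges_avoiding_def)
  then show ?thesis using simple_graph_finite(2)[OF assms]
    by (metis card_Un_disjoint degree_def finite_Un)
qed

text \<open>The set equation records at once that \<open>{u, v}\<close> is an edge and that it is
  the only one at \<open>v\<close>, which is how the deletion lemmas receive a pendant
  vertex.\<close>

lemma pendant_obtain:
  assumes "simple_graph G" "degree G v = 1"
  obtains u where "{e \<in> edges G. v \<in> e} = {{u, v}}" "u \<noteq> v" "u \<in> verts G"
proof -
  obtain e where e: "{e \<in> edges G. v \<in> e} = {e}"
    using assms(2) by (auto simp: degree_def card_1_singleton_iff)
  then have "e \<in> edges G" "v \<in> e" by auto
  then obtain u where u: "u \<noteq> v" "e = {v, u}" "u \<in> verts G" using edge_obtain[OF assms(1)] by metis
  then have "{e \<in> edges G. v \<in> e} = {{u, v}}" using e by (simp add: insert_commute)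
  then show ?thesis using that u by blast
qed

lemma connected_delete_pendant:
  assumes G: "simple_graph G" "connected_graph G"
    and v: "{e \<in> edges G. v \<in> e} = {{u, v}}" "u \<noteq> v" "u \<in> verts G"
  shows "connected_graph (delete_vertex G v)"
proof -
  let ?R = "(adj_rel (delete_vertex G v))\<^sup>*"
  have nb: "y = u" if "{y, v} \<in> edges G" for y
  proof -
    have "{y, v} \<in> {e \<in> edges G. v \<in> e}" using that by simp
    then show ?thesis unfolding v(1) by (auto simp: doubleton_eq_iff)
  qed
  \<comment> \<open>A walk that visits \<open>v\<close> enters and leaves it through \<open>u\<close>.\<close>
  have walk: "(x, if y = v then u else y) \<in> ?R" if "(x, y) \<in> (adj_rel G)\<^sup>*" "x \<noteq> v" for x y
    using that
  proof (induction rule: rtrancl_induct)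
    case (step y z)
    then have IH: "(x, if y = v then u else y) \<in> ?R" and yz: "{y, z} \<in> edges G"
      by (auto simp: adj_rel_def)
    consider "y = v" | "z = v" | "y \<noteq> v" "z \<noteq> v" by blast
    then show ?case
    proof cases
      case 1
      then have "z = u" using nb[of z] yz by (simp add: insert_commute)
      then show ?thesis using IH 1 v(2) by simp
    next
      case 2
      then have "y = u" using nb[of y] yz by simp
      then show ?thesis using IH 2 v(2) by simp
    next
      case 3
      then have "(y, z) \<in> adj_rel (delete_vertex G v)"
        using yz by (simp add: adj_rel_def edges_avoiding_def)
      then show ?thesis using IH 3 by (simp add: rtrancl_into_rtrancl)
    qed
  qed simp
  show ?thesis unfolding connected_graph_def
  proof (intro conjI ballI)
    show "verts (delete_vertex G v) \<noteq> {}" using v by auto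
    fix x y assume "x \<in> verts (delete_vertex G v)" "y \<in> verts (delete_vertex G v)"
    then have xy: "x \<noteq> v" "y \<noteq> v" "x \<in> verts G" "y \<in> verts G" by auto
    then have "(x, y) \<in> (adj_rel G)\<^sup>*" using G(2) by (simp add: connected_graph_def)
    from walk[OF this xy(1)] show "(x, y) \<in> ?R" using xy(2) by simp
  qed
qed

text \<open>Deleting \<open>v\<close> removes one edge of degree \<open>d - 1\<close> and lowers the
  degree of exactly the other \<open>d - 1\<close> edges at \<open>u\<close> by one. What must be
  bounded is the degree sum over the neighbours of \<open>u\<close>: it is the degree sum of all
  vertices other than \<open>u\<close> minus that of the non-neighbours, each of which has degree at
  least 1.\<close>

lemma EM1_delete_pendant:
  assumes G: "simple_graph G" and pos: "\<And>w. w \<in> verts G \<Longrightarrow> 1 \<le> degree G w"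
    and v: "{e \<in> edges G. v \<in> e} = {{u, v}}" "u \<noteq> v" "u \<in> verts G" "v \<in> verts G"
  defines "d \<equiv> int (degree G u)"
  shows "EM1 G \<le> EM1 (delete_vertex G v) + 3 * d\<^sup>2 - 9 * d
    + 4 * int (card (edges G)) - 2 * int (card (verts G)) + 6"
proof -
  let ?G' = "delete_vertex G v" and ?m = "int (card (edges G))" and ?n = "int (card (verts G))"
  let ?A = "{e \<in> edges_avoiding G v. u \<in> e}"
  have fin: "finite (verts G)" "finite (edges G)" "finite (edges_avoiding G v)"
    using simple_graph_finite[OF G] by (auto simp: edges_avoiding_def)
  have E: "edges G = insert {u, v} (edges_avoiding G v)" and uv: "{u, v} \<notin> edges_avoiding G v"
    using v(1) by (auto simp: edges_avoiding_def)
  have inc: "{e \<in> edges G. u \<in> e} = insert {u, v} ?A" using v(1) by (auto simp: edges_avoiding_def)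
  have degv: "degree G v = 1" using v(1) by (simp add: degree_def)
  have cardA: "int (card ?A) = d - 1"
    using inc uv fin by (simp add: degree_def d_def)
  have deg: "int (degree G w) = int (degree ?G' w) + (if w = u then 1 else 0)" if "w \<noteq> v" for w
  proof (cases "w = u")
    case True
    then show ?thesis using cardA by (simp add: degree_def d_def)
  next
    case False
    then have "{e \<in> edges G. w \<in> e} = {e \<in> edges_avoiding G v. w \<in> e}" unfolding E using that by auto
    then show ?thesis using False by (simp add: degree_def)
  qed
  have ed: "edge_degree G e = edge_degree ?G' e + (if u \<in> e then 1 else 0)"
    if "e \<in> edges_avoiding G v" for e
  proof -
    have e: "e \<in> edges G" "v \<notin> e" using that by (auto simp: edges_avoiding_def)
    then have "finite e" using simple_graph_edge[OF G] by blast
    have "(\<Sum>w\<in>e. int (degree G w)) = (\<Sum>w\<in>e. int (degree ?G' w) + (if w = u then 1 else 0))"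
      using deg e(2) by (intro sum.cong refl) metis
    also have "\<dots> = (\<Sum>w\<in>e. int (degree ?G' w)) + (if u \<in> e then 1 else 0)"
      using \<open>finite e\<close> by (simp add: sum.distrib)
    finally show ?thesis by (simp add: edge_degree_def)
  qed
  have "EM1 G = (edge_degree G {u, v})\<^sup>2 + (\<Sum>e\<in>edges_avoiding G v. (edge_degree G e)\<^sup>2)"
    unfolding EM1_def E using uv fin by simp
  \<comment> \<open>If \<open>a\<close> is the degree of an edge before the deletion and
    \<open>a - 1\<close> after it, its square drops by \<open>2 * a - 1\<close>.\<close>
  also have "(\<Sum>e\<in>edges_avoiding G v. (edge_degree G e)\<^sup>2) = (\<Sum>e\<in>edges_avoiding G v.
      (edge_degree ?G' e)\<^sup>2 + (if u \<in> e then 2 * edge_degree G e - 1 else 0))"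
    by (rule sum.cong) (auto simp: ed power2_eq_square algebra_simps)
  also have "\<dots> = EM1 ?G' + (\<Sum>e\<in>?A. 2 * edge_degree G e - 1)"
    using fin by (simp add: sum.distrib EM1_def sum.inter_filter)
  also have "(\<Sum>e\<in>?A. 2 * edge_degree G e - 1) = 2 * (\<Sum>e\<in>?A. edge_degree G e) - (d - 1)"
    using cardA by (simp add: sum_subtractf sum_distrib_left)
  finally have 1: "EM1 G = (d - 1)\<^sup>2 + EM1 ?G' + 2 * (\<Sum>e\<in>?A. edge_degree G e) - (d - 1)"
    using v(2) degv by (simp add: edge_degree_def d_def)
  \<comment> \<open>The summand \<open>d - 1\<close> is the degree of the pendant edge; adding it
    completes the sum to all edges at \<open>u\<close>.\<close>
  have "(\<Sum>e\<in>?A. edge_degree G e) + (d - 1) = (\<Sum>e\<in>{e \<in> edges G. u \<in> e}. edge_degree G e)"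
    unfolding inc using uv fin v(2) degv by (simp add: edge_degree_def d_def)
  also have "\<dots> = (\<Sum>w\<in>verts G. int (codegree G u w) * int (degree G w)) - 2 * d"
    unfolding sum_incident_edges_sum[OF G, symmetric]
    by (simp add: edge_degree_def sum_subtractf d_def degree_def)
  also have "(\<Sum>w\<in>verts G. int (codegree G u w) * int (degree G w)) =
      d * d + (\<Sum>w\<in>verts G - {u}. int (codegree G u w) * int (degree G w))"
    using fin v(3) by (simp add: sum.remove d_def)
  also have "(\<Sum>w\<in>verts G - {u}. int (codegree G u w) * int (degree G w)) \<le>
      (\<Sum>w\<in>verts G - {u}. int (degree G w) - 1 + int (codegree G u w))"
  proof (rule sum_mono)
    fix w assume w: "w \<in> verts G - {u}"
    then have "codegree G u w \<le> 1" "1 \<le> degree G w"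
      using codegree_le_1[OF G, of u w] pos[of w] by auto
    \<comment> \<open>For adjacent \<open>w\<close> the product vanishes and nothing is lost; for
      non-adjacent \<open>w\<close> the loss is \<open>degree G w - 1\<close>.\<close>
    then have "0 \<le> (int (degree G w) - 1) * (1 - int (codegree G u w))" by simp
    then show "int (codegree G u w) * int (degree G w) \<le> int (degree G w) - 1 + int (codegree G u w)"
      by (simp add: algebra_simps)
  qed
  \<comment> \<open>The term at \<open>u\<close> is \<open>2 * d - 1\<close>, because the codegree
    of \<open>u\<close> with itself is \<open>d\<close>.\<close>
  also have "\<dots> = (\<Sum>w\<in>verts G. int (degree G w) - 1 + int (codegree G u w)) - (2 * d - 1)"
    using fin v(3) by (simp add: sum.remove d_def)
  also have "(\<Sum>w\<in>verts G. int (degree G w) - 1 + int (codegree G u w)) = 2 * ?m - ?n + 2 * d"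
  proof -
    \<comment> \<open>Each of the \<open>d\<close> edges at \<open>u\<close> is counted once for
      each of its two ends.\<close>
    have "(\<Sum>w\<in>verts G. int (codegree G u w)) = (\<Sum>e\<in>{e \<in> edges G. u \<in> e}. \<Sum>w\<in>e. 1)"
      using sum_incident_edges_sum[OF G, of "\<lambda>_. 1" u] by simp
    also have "\<dots> = (\<Sum>e\<in>{e \<in> edges G. u \<in> e}. 2)"
      using simple_graph_edge(2)[OF G] by (intro sum.cong) auto
    finally have "(\<Sum>w\<in>verts G. int (codegree G u w)) = 2 * d" by (simp add: d_def degree_def)
    then show ?thesis using sum_degree[OF G] by (simp add: sum.distrib sum_subtractf)
  qed
  finally have 2: "(\<Sum>e\<in>?A. edge_degree G e) \<le> d * d - 3 * d + 2 * ?m - ?n + 2" by simp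
  show ?thesis using 1 2 by (simp add: power2_eq_square algebra_simps)
qed

section \<open>Graphs without pendant vertices\<close>

text \<open>Only the quadratic factor, which is increasing for nonnegative arguments, is replaced by
  its value at \<open>k\<close>. The factor \<open>x\<close> is kept so that the bound is linear in
  \<open>x\<close> and can be summed when the total of the \<open>x\<close> is known.\<close>

lemma cubic_bound:
  fixes x k :: int
  assumes "0 \<le> x" "x \<le> k"
  shows "x * (x\<^sup>2 + 5 * x + 12) \<le> x * (k\<^sup>2 + 5 * k + 12)"
    and "x * (x\<^sup>2 + 5 * x + 12) = x * (k\<^sup>2 + 5 * k + 12) \<Longrightarrow> x = 0 \<or> x = k"
proof -
  have "x\<^sup>2 \<le> k\<^sup>2" using assms by (rule power_mono[rotated])
  then show "x * (x\<^sup>2 + 5 * x + 12) \<le> x * (k\<^sup>2 + 5 * k + 12)"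
    using assms by (intro mult_left_mono add_right_mono add_mono) auto
  assume "x * (x\<^sup>2 + 5 * x + 12) = x * (k\<^sup>2 + 5 * k + 12)"
  then have "x = 0 \<or> x\<^sup>2 + 5 * x = k\<^sup>2 + 5 * k" by simp
  \<comment> \<open>Neither \<open>x\<^sup>2\<close> nor \<open>5 * x\<close> exceeds its
    counterpart in \<open>k\<close>, so equal sums force both to agree.\<close>
  then show "x = 0 \<or> x = k" using \<open>x\<^sup>2 \<le> k\<^sup>2\<close> assms by linarith
qed

text \<open>An edge has degree 2 plus the excesses of its ends, so the sum of squares turns into a
  sum of one term \<open>t v\<close> per vertex. Each term is compared with a multiple of
  \<open>x v\<close>, and equality overall forces every excess to an end of its range
  \<open>0..k\<close>.\<close>

lemma EM1_no_pendant:
  assumes T: "tricyclic n G" and deg2: "\<And>v. v \<in> verts G \<Longrightarrow> 2 \<le> degree G v"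
  shows "EM1 G \<le> 4 * (int n)\<^sup>2 + 32"
    and "EM1 G = 4 * (int n)\<^sup>2 + 32 \<Longrightarrow> v \<in> verts G \<Longrightarrow> degree G v = 2 \<or> degree G v = n - 1"
proof -
  have G: "simple_graph G" "card (verts G) = n" "card (edges G) = n + 2"
    using T by (auto simp: tricyclic_def)
  have fin: "finite (verts G)" using simple_graph_finite[OF G(1)] by blast
  define x where "x v = int (degree G v) - 2" for v
  define s where "s e = (\<Sum>v\<in>e. x v)" for e
  \<comment> \<open>The largest possible excess, since degrees are at most
    \<open>n - 1\<close>.\<close>
  define k where "k = int n - 3"
  have x: "0 \<le> x v" "x v \<le> k" if "v \<in> verts G" for v
    using deg2[OF that] degree_less_card[OF G(1) that] G(2) by (auto simp: x_def k_def)
  have sumx: "(\<Sum>v\<in>verts G. x v) = 4"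
    using sum_degree[OF G(1)] G by (simp add: x_def sum_subtractf)
  have "EM1 G = (\<Sum>e\<in>edges G. (2 + s e)\<^sup>2)"
    unfolding EM1_def using simple_graph_edge(2)[OF G(1)]
    by (intro sum.cong refl) (simp add: edge_degree_def s_def x_def sum_subtractf)
  also have "\<dots> = (\<Sum>e\<in>edges G. 4 + 4 * s e + s e * s e)"
    by (intro sum.cong) (auto simp: power2_eq_square algebra_simps)
  also have "\<dots> = 4 * (int n + 2) + 4 * (\<Sum>e\<in>edges G. s e) + (\<Sum>e\<in>edges G. s e * s e)"
    using G(3) by (simp add: sum.distrib sum_distrib_left)
  also have "(\<Sum>e\<in>edges G. s e) = (\<Sum>v\<in>verts G. x v * (x v + 2))"
    unfolding s_def sum_edges_sum[OF G(1) order_refl]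
    by (simp add: x_def degree_def[symmetric] mult.commute)
  \<comment> \<open>One factor of the square is opened into its two ends, so that after the swap
    \<open>x v\<close> meets only the edges at \<open>v\<close>.\<close>
  also have "(\<Sum>e\<in>edges G. s e * s e) = (\<Sum>e\<in>edges G. \<Sum>v\<in>e. x v * s e)"
    by (simp add: s_def sum_distrib_right)
  also have "\<dots> = (\<Sum>v\<in>verts G. x v * (\<Sum>e\<in>{e \<in> edges G. v \<in> e}. s e))"
    unfolding sum_edges_swap[OF G(1) order_refl] by (simp add: sum_distrib_left)
  finally have EM: "EM1 G = 4 * int n + 8 +
      (\<Sum>v\<in>verts G. x v * (4 * x v + 8 + (\<Sum>e\<in>{e \<in> edges G. v \<in> e}. s e)))"
    by (simp add: sum.distrib[symmetric] sum_distrib_left algebra_simps)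
  \<comment> \<open>The vertex \<open>v\<close> lies in all \<open>x v + 2\<close> edges at it,
    every other vertex in at most one. Passing from the neighbours to all other vertices bounds
    their share by \<open>4 - x v\<close>.\<close>
  have inc: "(\<Sum>e\<in>{e \<in> edges G. v \<in> e}. s e) \<le> (x v)\<^sup>2 + x v + 4" if v: "v \<in> verts G" for v
  proof -
    have "(\<Sum>e\<in>{e \<in> edges G. v \<in> e}. s e) =
        (x v + 2) * x v + (\<Sum>w\<in>verts G - {v}. int (codegree G v w) * x w)"
      unfolding s_def sum_incident_edges_sum[OF G(1)]
      using fin v by (simp add: sum.remove x_def)
    also have "(\<Sum>w\<in>verts G - {v}. int (codegree G v w) * x w) \<le> (\<Sum>w\<in>verts G - {v}. x w)"
    proof (rule sum_mono)
      fix w assume "w \<in> verts G - {v}"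
      then have "int (codegree G v w) \<le> 1" "0 \<le> x w"
        using codegree_le_1[OF G(1), of v w] x by auto
      then show "int (codegree G v w) * x w \<le> x w" by (simp add: mult_left_le_one_le)
    qed
    also have "\<dots> = 4 - x v" using sumx fin v by (simp add: sum_diff1)
    finally show ?thesis by (simp add: power2_eq_square algebra_simps)
  qed
  define t where "t v = x v * (4 * x v + 8 + (\<Sum>e\<in>{e \<in> edges G. v \<in> e}. s e))" for v
  have t: "t v \<le> x v * ((x v)\<^sup>2 + 5 * x v + 12)" if v: "v \<in> verts G" for v
    unfolding t_def using inc[OF v] x[OF v] by (intro mult_left_mono) auto
  have t2: "t v \<le> x v * (k\<^sup>2 + 5 * k + 12)" if v: "v \<in> verts G" for v
    using t[OF v] cubic_bound(1)[OF x[OF v]] by linarith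
  have total: "4 * int n + 8 + (\<Sum>v\<in>verts G. x v * (k\<^sup>2 + 5 * k + 12)) = 4 * (int n)\<^sup>2 + 32"
    unfolding sum_distrib_right[symmetric] sumx
    by (simp add: k_def power2_eq_square algebra_simps)
  show "EM1 G \<le> 4 * (int n)\<^sup>2 + 32"
    unfolding EM total[symmetric] t_def[symmetric] using t2 by (simp add: sum_mono)
  assume "EM1 G = 4 * (int n)\<^sup>2 + 32" and v: "v \<in> verts G"
  \<comment> \<open>The gaps between bound and term are nonnegative with sum zero, so each of them
    vanishes.\<close>
  then have "(\<Sum>v\<in>verts G. x v * (k\<^sup>2 + 5 * k + 12) - t v) = 0"
    unfolding EM total[symmetric] t_def[symmetric] by (simp add: sum_subtractf)
  then have "x v * (k\<^sup>2 + 5 * k + 12) - t v = 0"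
    using sum_nonneg_eq_0_iff[OF fin, of "\<lambda>v. x v * (k\<^sup>2 + 5 * k + 12) - t v"] t2 v by auto
  then have "x v = 0 \<or> x v = k"
    using t[OF v] cubic_bound[OF x[OF v]] by linarith
  then show "degree G v = 2 \<or> degree G v = n - 1" by (auto simp: x_def k_def)
qed

section \<open>Equality without pendant vertices: orders four and five\<close>

lemma card_3_obtain:
  assumes "card A = 3"
  obtains p q r where "distinct [p, q, r]" "A = {p, q, r}"
  using assms by (auto simp: card_3_iff)

text \<open>Six edges on four vertices leave no pair non-adjacent: every degree is at most 3 and the
  degree sum is 12.\<close>

lemma complete_4_extremal:
  assumes T: "tricyclic 4 G" and c: "c \<in> verts G"
  shows "dominating G c" "is_triangle (edges_avoiding G c)"
proof -
  have G: "simple_graph G" "card (verts G) = 4" "card (edges G) = 6"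
    using T by (auto simp: tricyclic_def)
  have fin: "finite (verts G)" using simple_graph_finite[OF G(1)] by blast
  have "(\<Sum>v\<in>verts G. 3 - int (degree G v)) = 0"
    using sum_degree[OF G(1)] G by (simp add: sum_subtractf)
  moreover have "degree G v \<le> 3" if "v \<in> verts G" for v
    using degree_less_card[OF G(1) that] G(2) by simp
  ultimately have "\<forall>v\<in>verts G. 3 - int (degree G v) = 0"
    using sum_nonneg_eq_0_iff[OF fin, of "\<lambda>v. 3 - int (degree G v)"] by force
  then have dom: "dominating G v" if "v \<in> verts G" for v
    using dominating_iff_degree[OF G(1) that] G(2) that by auto
  then show "dominating G c" using c .
  have "card (verts G - {c}) = 3" using c G by simp
  then obtain p q r where pqr: "distinct [p, q, r]" "verts G - {c} = {p, q, r}"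
    by (rule card_3_obtain)
  have V: "verts G = {c, p, q, r}" using pqr(2) c by auto
  have "{{p, q}, {p, r}, {q, r}} \<subseteq> edges_avoiding G c"
    using dom[of p] dom[of q] pqr unfolding V by (auto simp: dominating_def edges_avoiding_def V)
  moreover have "card (edges_avoiding G c) = 3"
    using card_edges_avoiding[OF G(1), of c] dom[OF c] dominating_iff_degree[OF G(1) c] G by simp
  moreover have "card {{p, q}, {p, r}, {q, r}} = 3" using pqr(1) by (auto simp: doubleton_eq_iff)
  ultimately have "edges_avoiding G c = {{p, q}, {p, r}, {q, r}}"
    by (metis card_subset_eq card.infinite zero_neq_numeral)
  then show "is_triangle (edges_avoiding G c)" using pqr(1) unfolding is_triangle_def by blast
qed

text \<open>The vertex \<open>c\<close> takes four of the seven edges. The edges from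
  \<open>b\<close> to the three remaining vertices avoid \<open>c\<close> and already account for
  the other three.\<close>

lemma two_dominating_5_claw:
  assumes T: "tricyclic 5 G" and "dominating G c" "dominating G b" "b \<noteq> c"
  shows "is_claw (edges_avoiding G c)"
proof -
  have G: "simple_graph G" "card (verts G) = 5" "card (edges G) = 7"
    using T by (auto simp: tricyclic_def)
  have cb: "c \<in> verts G" "b \<in> verts G" using assms by (auto simp: dominating_def)
  then have "card (verts G - {c} - {b}) = 3" using G assms(4) by simp
  then obtain p q r where pqr: "distinct [p, q, r]" "verts G - {c} - {b} = {p, q, r}"
    by (rule card_3_obtain)
  then have d: "distinct [b, p, q, r]" "c \<notin> {b, p, q, r}" "{p, q, r} \<subseteq> verts G"
    using assms(4) by auto
  have "{{b, p}, {b, q}, {b, r}} \<subseteq> edges_avoiding G c"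
    using d assms(3) by (auto simp: dominating_def edges_avoiding_def)
  moreover have "card (edges_avoiding G c) = 3"
    using card_edges_avoiding[OF G(1), of c] assms(2) dominating_iff_degree[OF G(1) cb(1)] G by simp
  moreover have "card {{b, p}, {b, q}, {b, r}} = 3" using d(1) by (auto simp: doubleton_eq_iff)
  ultimately have "edges_avoiding G c = {{b, p}, {b, q}, {b, r}}"
    by (metis card_subset_eq card.infinite zero_neq_numeral)
  then show ?thesis using d(1) unfolding is_claw_def by blast
qed

text \<open>For \<open>n \<ge> 4\<close> the gap between the pendant-free bound and
  \<open>extremal_value n\<close> vanishes only at 4 and 5, so equality is settled by inspecting
  these two orders.\<close>

lemma tricyclic_no_pendant_extremal:
  assumes T: "tricyclic n G" and deg2: "\<And>v. v \<in> verts G \<Longrightarrow> 2 \<le> degree G v"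
  shows "EM1 G \<le> extremal_value n"
    and "EM1 G = extremal_value n \<Longrightarrow> \<exists>c. dominating G c"
    and "EM1 G = extremal_value n \<Longrightarrow> dominating G c \<Longrightarrow>
      is_claw (edges_avoiding G c) \<or> is_triangle (edges_avoiding G c)"
proof -
  have G: "simple_graph G" "card (verts G) = n" "card (edges G) = n + 2" "verts G \<noteq> {}"
    using T by (auto simp: tricyclic_def connected_graph_def)
  have fin: "finite (verts G)" using simple_graph_finite[OF G(1)] by blast
  have n4: "4 \<le> n" by (rule tricyclic_card_ge[OF T])
  have val: "extremal_value n = 4 * (int n)\<^sup>2 + 32 + int n * ((int n - 4) * (int n - 5))"
    by (simp add: extremal_value_def power2_eq_square power3_eq_cube algebra_simps)
  \<comment> \<open>No integer lies strictly between 4 and 5.\<close>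
  have "0 \<le> (int n - 4) * (int n - 5)" using n4 by (cases "n = 4") auto
  then have nonneg: "0 \<le> int n * ((int n - 4) * (int n - 5))" by simp
  note bound = EM1_no_pendant(1)[OF T deg2]
  show "EM1 G \<le> extremal_value n" using bound nonneg val by linarith
  have eq: "EM1 G = 4 * (int n)\<^sup>2 + 32" "n = 4 \<or> n = 5" if "EM1 G = extremal_value n"
  proof -
    show "EM1 G = 4 * (int n)\<^sup>2 + 32" using bound nonneg val that by linarith
    then have "int n * ((int n - 4) * (int n - 5)) = 0" using val that by linarith
    then show "n = 4 \<or> n = 5" using n4 by auto
  qed
  \<comment> \<open>On five vertices an excess is at most 2, so the total 4 needs two vertices of
    full degree, and a set \<open>B\<close> of at most one vertex cannot contain both. With
    \<open>B\<close> empty this gives a centre, with \<open>B = {c}\<close> a second one.\<close>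
  have five: "\<exists>b. dominating G b \<and> b \<notin> B"
    if "EM1 G = extremal_value n" "n = 5" "finite B" "B \<subseteq> verts G" "card B \<le> 1" for B
  proof (rule ccontr)
    assume no: "\<not> ?thesis"
    have two: "degree G v = 2" if "v \<in> verts G - B" for v
    proof -
      have "\<not> dominating G v" using no that by blast
      then have "degree G v \<noteq> n - 1" using dominating_iff_degree[OF G(1)] G(2) that by blast
      then show ?thesis
        using EM1_no_pendant(2)[OF T deg2 eq(1)[OF \<open>EM1 G = extremal_value n\<close>]] that by blast
    qed
    have "4 = (\<Sum>v\<in>verts G. int (degree G v) - 2)"
      using sum_degree[OF G(1)] G by (simp add: sum_subtractf)
    also have "\<dots> = (\<Sum>v\<in>B. int (degree G v) - 2)"
    proof (rule sum.mono_neutral_right[OF fin \<open>B \<subseteq> verts G\<close>])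
      show "\<forall>v\<in>verts G - B. int (degree G v) - 2 = 0"
      proof
        fix v assume "v \<in> verts G - B"
        then have "degree G v = 2" by (rule two)
        then show "int (degree G v) - 2 = 0" by simp
      qed
    qed
    also have "\<dots> \<le> (\<Sum>v\<in>B. 2)"
    proof (rule sum_mono)
      fix v assume "v \<in> B"
      then have "v \<in> verts G" using \<open>B \<subseteq> verts G\<close> by blast
      from degree_less_card[OF G(1) this] have "degree G v < 5" using G(2) \<open>n = 5\<close> by simp
      then show "int (degree G v) - 2 \<le> 2" by simp
    qed
    finally show False using \<open>card B \<le> 1\<close> by simp
  qed
  show "\<exists>c. dominating G c" if "EM1 G = extremal_value n"
    using eq(2)[OF that]
  proof
    assume "n = 4"
    then have "tricyclic 4 G" using T by simp
    moreover obtain c where "c \<in> verts G" using G(4) by auto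
    ultimately show ?thesis using complete_4_extremal(1) by (intro exI)
  next
    assume "n = 5"
    then show ?thesis using five[OF that, of "{}"] by auto
  qed
  show "is_claw (edges_avoiding G c) \<or> is_triangle (edges_avoiding G c)"
    if ev: "EM1 G = extremal_value n" and c: "dominating G c"
  proof -
    have cV: "c \<in> verts G" using c by (simp add: dominating_def)
    from eq(2)[OF ev] show ?thesis
    proof
      assume "n = 4"
      then have "tricyclic 4 G" using T by simp
      from complete_4_extremal(2)[OF this cV] show ?thesis ..
    next
      assume n: "n = 5"
      then obtain b where b: "dominating G b" "b \<noteq> c" using five[OF ev, of "{c}"] cV by auto
      have "tricyclic 5 G" using T n by simp
      from two_dominating_5_claw[OF this c b] show ?thesis ..
    qed
  qed
qed

section \<open>The extremal graphs\<close>

lemma tricyclic_extremal: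
  assumes "tricyclic n G"
  shows "EM1 G \<le> extremal_value n \<and> (EM1 G = extremal_value n \<longrightarrow>
    (\<exists>c. dominating G c) \<and>
    (\<forall>c. dominating G c \<longrightarrow> is_claw (edges_avoiding G c) \<or> is_triangle (edges_avoiding G c)))"
  using assms
proof (induction n arbitrary: G)
  \<comment> \<open>The real base of the induction is the pendant-free case, treated at every order;
    an empty graph is merely excluded.\<close>
  case 0
  then show ?case using tricyclic_card_ge by fastforce
next
  case (Suc n)
  have G: "simple_graph G" "connected_graph G" "card (verts G) = Suc n" "card (edges G) = Suc n + 2"
    using Suc.prems by (auto simp: tricyclic_def)
  have "4 \<le> Suc n" by (rule tricyclic_card_ge[OF Suc.prems])
  then have pos: "1 \<le> degree G v" if "v \<in> verts G" for v
    using connected_degree_pos[OF G(1,2) _ that] G(3) by linarith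
  show ?case
  proof (cases "\<exists>v\<in>verts G. degree G v = 1")
    case False
    then have "2 \<le> degree G v" if "v \<in> verts G" for v
      using pos[OF that] that by (metis One_nat_def Suc_1 le_antisym not_less_eq_eq)
    then show ?thesis using tricyclic_no_pendant_extremal[OF Suc.prems] by blast
  next
    case True
    then obtain v where v: "v \<in> verts G" "degree G v = 1" by blast
    then obtain u where u: "{e \<in> edges G. v \<in> e} = {{u, v}}" "u \<noteq> v" "u \<in> verts G"
      using pendant_obtain[OF G(1)] by metis
    let ?G' = "delete_vertex G v"
    have T': "tricyclic n ?G'"
      unfolding tricyclic_def
      using simple_graph_delete_vertex[OF G(1)] connected_delete_pendant[OF G(1,2) u]
        card_edges_avoiding[OF G(1), of v] v G by simp
    then have n4: "4 \<le> n" by (rule tricyclic_card_ge)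
    define d where "d = int (degree G u)"
    have d: "1 \<le> d" "d \<le> int n"
      using pos[OF u(3)] degree_less_card[OF G(1) u(3)] G(3) by (auto simp: d_def)
    \<comment> \<open>Here \<open>G\<close> has \<open>n + 1\<close> vertices and
      \<open>n + 3\<close> edges, which gives
      \<open>4 * (n + 3) - 2 * (n + 1) + 6 = 2 * n + 16\<close>.\<close>
    have "EM1 G \<le> EM1 ?G' + 3 * d\<^sup>2 - 9 * d + 2 * int n + 16"
      using EM1_delete_pendant[OF G(1) pos u v(1)] G(3,4) by (simp add: d_def)
    \<comment> \<open>The increment of \<open>extremal_value\<close> is the preceding quadratic in
      \<open>d\<close> evaluated at \<open>d = n\<close>, so the difference has the factor
      \<open>n - d\<close>.\<close>
    also have "\<dots> = EM1 ?G' - extremal_value n + extremal_value (Suc n)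
        - 3 * ((int n - d) * (int n + d - 3))"
      by (simp add: extremal_value_def power2_eq_square power3_eq_cube algebra_simps)
    finally have step: "EM1 G \<le> EM1 ?G' - extremal_value n + extremal_value (Suc n)
        - 3 * ((int n - d) * (int n + d - 3))" .
    have nonneg: "0 \<le> (int n - d) * (int n + d - 3)" using d n4 by simp
    note IH = Suc.IH[OF T']
    have "EM1 G \<le> extremal_value (Suc n)" using step nonneg IH by linarith
    moreover have "(\<exists>c. dominating G c) \<and> (\<forall>c. dominating G c \<longrightarrow>
        is_claw (edges_avoiding G c) \<or> is_triangle (edges_avoiding G c))"
      if eq: "EM1 G = extremal_value (Suc n)"
    proof -
      \<comment> \<open>The second factor is positive by \<open>4 \<le> n\<close> and
        \<open>1 \<le> d\<close>, so equality makes \<open>u\<close> adjacent to all other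
        vertices.\<close>
      have "(int n - d) * (int n + d - 3) = 0" using step nonneg IH eq by linarith
      then have "degree G u = n" using d n4 by (auto simp: d_def)
      then have dom: "dominating G u" using dominating_iff_degree[OF G(1) u(3)] G(3) by simp
      have "EM1 ?G' = extremal_value n" using step nonneg IH eq by linarith
      moreover have "dominating ?G' u"
        using dom u(2) by (auto simp: dominating_def edges_avoiding_def)
      ultimately have "is_claw (edges_avoiding ?G' u) \<or> is_triangle (edges_avoiding ?G' u)"
        using IH by blast
      \<comment> \<open>The only deleted edge contains \<open>u\<close>.\<close>
      moreover have "edges_avoiding ?G' u = edges_avoiding G u"
        using u(1) by (auto simp: edges_avoiding_def)
      ultimately have shape: "is_claw (edges_avoiding G u) \<or> is_triangle (edges_avoiding G u)"
        by simp
      \<comment> \<open>A vertex adjacent to all others is not the pendant \<open>v\<close>, hence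
        is adjacent to \<open>v\<close>, whose only neighbour is \<open>u\<close>.\<close>
      have unique: "c = u" if c: "dominating G c" for c
      proof -
        have "c \<noteq> v" using c v n4 dominating_iff_degree[OF G(1) v(1)] G(3) by auto
        then have "{c, v} \<in> {e \<in> edges G. v \<in> e}" using c v(1) by (auto simp: dominating_def)
        then show ?thesis unfolding u(1) using \<open>c \<noteq> v\<close> by (auto simp: doubleton_eq_iff)
      qed
      show ?thesis
      proof (intro conjI allI impI)
        show "\<exists>c. dominating G c" using dom by (rule exI)
        fix c assume "dominating G c"
        then have "c = u" by (rule unique)
        then show "is_claw (edges_avoiding G c) \<or> is_triangle (edges_avoiding G c)"
          using shape by simp
      qed
    qed
    ultimately show ?thesis by blast
  qed
qed

section \<open>The bound and the identification of the extremal graphs\<close>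

theorem theorem3p2:
  fixes G :: "'a graph" and n :: nat
  assumes "tricyclic n G"
  shows "EM1 G \<le> int n ^ 3 - 5 * int n ^ 2 + 20 * int n + 32 \<and>
    (EM1 G = int n ^ 3 - 5 * int n ^ 2 + 20 * int n + 32 \<longleftrightarrow>
       (5 \<le> n \<and> G \<cong>\<^sub>g star_join n (n + 2)) \<or> (4 \<le> n \<and> G \<cong>\<^sub>g star_K4 n))"
proof -
  have G: "simple_graph G" "card (verts G) = n" using assms by (auto simp: tricyclic_def)
  have n4: "4 \<le> n" by (rule tricyclic_card_ge[OF assms])
  note ext = tricyclic_extremal[OF assms]
  have "5 \<le> n \<and> G \<cong>\<^sub>g star_join n (n + 2) \<or> 4 \<le> n \<and> G \<cong>\<^sub>g star_K4 n"
    if ev: "EM1 G = extremal_value n"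
  proof -
    obtain c where c: "dominating G c"
      and "is_claw (edges_avoiding G c) \<or> is_triangle (edges_avoiding G c)"
      using ext ev by blast
    then show ?thesis
    proof (elim disjE)
      assume claw: "is_claw (edges_avoiding G c)"
      then obtain a p q r where d: "distinct [a, p, q, r]" and
        E: "edges_avoiding G c = {{a, p}, {a, q}, {a, r}}" unfolding is_claw_def by blast
      have sub: "{a, p, q, r} \<subseteq> verts G - {c}" using edges_avoiding_subset[OF G(1)] E by auto
      have "c \<in> verts G" using c by (simp add: dominating_def)
      then have "card (verts G - {c}) = n - 1" using G(2) by simp
      moreover have "card {a, p, q, r} = 4" using d by simp
      moreover have "finite (verts G - {c})" using simple_graph_finite(1)[OF G(1)] by simp
      \<comment> \<open>The four vertices of the claw and the centre they avoid are five distinct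
        vertices.\<close>
      ultimately have n5: "5 \<le> n" using card_mono[OF _ sub] n4 by simp
      note S = star_join_dominating_claw[OF n5]
      have "G \<cong>\<^sub>g star_join n (n + 2)"
        by (rule graph_iso_dominating_claw[OF G(1) c claw S(1-3)]) (simp only: S(4) G(2))
      then show ?thesis using n5 by simp
    next
      assume triangle: "is_triangle (edges_avoiding G c)"
      note S = star_K4_dominating_triangle[OF n4]
      have "G \<cong>\<^sub>g star_K4 n"
        by (rule graph_iso_dominating_triangle[OF G(1) c triangle S(1-3)]) (simp only: S(4) G(2))
      then show ?thesis using n4 by simp
    qed
  qed
  \<comment> \<open>Conversely, the value is computed on the named graph and transported along the
    isomorphism.\<close>
  moreover have "EM1 G = extremal_value n" if "5 \<le> n" "G \<cong>\<^sub>g star_join n (n + 2)"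
    using EM1_graph_iso[OF G(1) that(2)] star_join_dominating_claw(4)[OF that(1)]
      EM1_dominating_claw[OF star_join_dominating_claw(1-3)[OF that(1)]] by simp
  moreover have "EM1 G = extremal_value n" if "G \<cong>\<^sub>g star_K4 n"
    using EM1_graph_iso[OF G(1) that] star_K4_dominating_triangle(4)[OF n4]
      EM1_dominating_triangle[OF star_K4_dominating_triangle(1-3)[OF n4]] by simp
  ultimately show ?thesis using ext unfolding extremal_value_def by blast
qed

end
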